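(* Let $\theta_k:=2^{-k}$ for all $k\in\mathbb{N}$, let $(N_k)_{k\in\mathbb{N}}$ be a sequence of positive integers, and let $$\boldsymbol{\theta}=\left\{\theta_{k+1}+\frac{i-1}{N_k}(\theta_k-\theta_{k+1}) : k\in\mathbb{N},\ 1\leq i\leq N_k\right\}.$$ For $k\in\mathbb{N}$ let $\sigma_k:=\dfrac{4}{\sin(2^{-k-1}/N_k)}$, and let $\boldsymbol{\sigma}:\boldsymbol{\theta}\to[1,+\infty)$ be defined by $\boldsymbol{\sigma}\left(\theta_{k+1}+\frac{i-1}{N_k}(\theta_k-\theta_{k+1})\right)=\sigma_k$ for all $k\in\mathbb{N}$ and $1\leq i\leq N_k$. If, for some $\alpha>0$, one has $k^\alpha=o(N_k)$ as $k\to\infty$, then $\mathscr{B}^{\boldsymbol{\sigma}}$ fails to differentiate $L\log^\alpha L(\mathbb{R}^2)$.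
   Context: Rectangles in $\mathbb{R}^2$ are open and nondegenerate, with arbitrary orientation. The shape $\sigma(R)$ of a rectangle $R$ is the quotient of its longest side-length by its shortest side-length. $\mathscr{B}^{\boldsymbol{\sigma}}$ denotes the collection of all rectangles $R$ for which there exists $\theta\in\boldsymbol{\theta}$ such that the longest side of $R$ makes an angle $\theta$ with the horizontal line and $\sigma(R)=\boldsymbol{\sigma}(\theta)$ (all positions and all sizes are allowed). A (Buseman-Feller) differentiation basis is a collection $\mathscr{B}$ of open subsets of $\mathbb{R}^2$ such that $\inf\{\operatorname{diam}B: B\in\mathscr{B},\ x\in B\}=0$ for every $x\in\mathbb{R}^2$. For $f\in L^1_{\mathrm{loc}}(\mathbb{R}^2)$, $\mathscr{B}$ differentiates $\int f$ if for a.e. $x\in\mathbb{R}^2$ one has $\frac{1}{|B|}\int_B f\to f(x)$ as $\operatorname{diam}B\to0$ with $x\in B\in\mathscr{B}$. For $X\subseteq L^1_{\mathrm{loc}}(\mathbb{R}^2)$, $\mathscr{B}$ differentiates $X$ if it differentiates $\int f$ for every $f\in X$. $L\log^\alpha L(\mathbb{R}^2)$ is the Orlicz space associated with $\Phi(t)=t(1+\log_+^\alpha t)$, i.e. the space of measurable $f$ with $\int_{\mathbb{R}^2}|f|\,(1+\log_+^\alpha|f|)<\infty$, where $\log_+t=\max(\log t,0)$ for $t>0$ (with value $0$ at $t=0$) and $\log_+^\alpha t=(\log_+t)^\alpha$. For nonnegative $a_k$ and positive $b_k$, $a_k=o(b_k)$ means $a_k/b_k\to0$ as $k\to\infty$.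 *)

theory Defs
  imports "HOL-Analysis.Analysis" "HOL-Library.Landau_Symbols"
begin

text \<open>The open rectangle with centre \<open>c\<close>, whose sides of length \<open>a\<close> make the (oriented) angle
  \<open>t\<close> with the horizontal axis and whose sides of length \<open>b\<close> are orthogonal to them.\<close>

definition rect :: "real^2 \<Rightarrow> real \<Rightarrow> real \<Rightarrow> real \<Rightarrow> (real^2) set" where
  "rect c t a b =
     {x. \<bar>(x - c) \<bullet> vector [cos t, sin t]\<bar> < a / 2 \<and> \<bar>(x - c) \<bullet> vector [- sin t, cos t]\<bar> < b / 2}"

text \<open>Since \<open>b \<le> a\<close>, the longest side of \<open>rect c t a b\<close> is the one of direction \<open>t\<close>
  and the shape of the rectangle is \<open>a / b\<close>. Only the values of \<open>\<sigma>\<close> on \<open>\<Theta>\<close> matter.\<close>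

definition rectangle_basis :: "real set \<Rightarrow> (real \<Rightarrow> real) \<Rightarrow> (real^2) set set" where
  "rectangle_basis \<Theta> \<sigma> =
     {R. \<exists>t\<in>\<Theta>. \<exists>c a b. 0 < b \<and> b \<le> a \<and> R = rect c t a b \<and> a / b = \<sigma> t}"

text \<open>The library's \<^const>\<open>diameter\<close> is real-valued and meaningless on unbounded sets, which have
  infinite diameter; hence the explicit boundedness below. The condition at each \<open>x\<close> says that the
  infimum of the diameters of the members containing \<open>x\<close> (infinite if there are none) is zero.\<close>

definition differentiation_basis :: "(real^2) set set \<Rightarrow> bool" where
  "differentiation_basis \<B> \<longleftrightarrow>
     (\<forall>B\<in>\<B>. open B) \<and>
     (\<forall>x. \<forall>\<epsilon>>0. \<exists>B\<in>\<B>. x \<in> B \<and> bounded B \<and> diameter B < \<epsilon>)"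

definition average :: "(real^2 \<Rightarrow> real) \<Rightarrow> (real^2) set \<Rightarrow> real" where
  "average f B = 1 / measure lebesgue B * (LINT x:B|lebesgue. f x)"

text \<open>Meant for locally integrable \<open>f\<close>.\<close>

definition differentiates_integral :: "(real^2) set set \<Rightarrow> (real^2 \<Rightarrow> real) \<Rightarrow> bool" where
  "differentiates_integral \<B> f \<longleftrightarrow>
     (AE x in lebesgue. \<forall>\<epsilon>>0. \<exists>\<delta>>0. \<forall>B\<in>\<B>.
        x \<in> B \<and> bounded B \<and> diameter B < \<delta> \<longrightarrow> \<bar>average f B - f x\<bar> < \<epsilon>)"

definition differentiates :: "(real^2) set set \<Rightarrow> (real^2 \<Rightarrow> real) set \<Rightarrow> bool" where
  "differentiates \<B> X \<longleftrightarrow> (\<forall>f\<in>X. differentiates_integral \<B> f)"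

definition log_plus :: "real \<Rightarrow> real" where
  "log_plus t = (if t > 0 then max (ln t) 0 else 0)"

text \<open>Every \<open>f\<close> in this space is integrable, as \<open>\<bar>f\<bar>\<close> is dominated by the integrand.\<close>

definition LlogL :: "real \<Rightarrow> (real^2 \<Rightarrow> real) set" where
  "LlogL \<alpha> = {f \<in> borel_measurable lebesgue.
     (\<integral>\<^sup>+x. ennreal (\<bar>f x\<bar> * (1 + log_plus \<bar>f x\<bar> powr \<alpha>)) \<partial>lebesgue) < \<infinity>}"

definition theta :: "nat \<Rightarrow> real" where
  "theta k = 1 / 2 ^ k"

definition angle :: "(nat \<Rightarrow> nat) \<Rightarrow> nat \<Rightarrow> nat \<Rightarrow> real" where
  "angle N k i = theta (k + 1) + (real i - 1) / real (N k) * (theta k - theta (k + 1))"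

definition angle_set :: "(nat \<Rightarrow> nat) \<Rightarrow> real set" where
  "angle_set N = {angle N k i | k i. 1 \<le> i \<and> i \<le> N k}"

definition level_shape :: "(nat \<Rightarrow> nat) \<Rightarrow> nat \<Rightarrow> real" where
  "level_shape N k = 4 / sin ((1 / 2 ^ (k + 1)) / real (N k))"


lemma open_rect: "open (rect c t a b)"
  unfolding rect_def
  by (intro open_Collect_conj open_Collect_less continuous_intros)

lemma rect_subset_cball:
  assumes "0 < b" "b \<le> a"
  shows "rect c t a b \<subseteq> cball c a"
proof
  fix x assume x: "x \<in> rect c t a b"
  define y where "y = x - c"
  define p q where "p = y $ 1 * cos t + y $ 2 * sin t" and "q = y $ 2 * cos t - y $ 1 * sin t"
  have p: "\<bar>p\<bar> < a / 2" and q: "\<bar>q\<bar> < b / 2"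
    using x unfolding rect_def p_def q_def y_def by (auto simp: inner_vec_def sum_2 algebra_simps)
  have "p\<^sup>2 + q\<^sup>2 = ((y $ 1)\<^sup>2 + (y $ 2)\<^sup>2) * ((sin t)\<^sup>2 + (cos t)\<^sup>2)"
    unfolding p_def q_def by algebra
  then have "p\<^sup>2 + q\<^sup>2 = (y $ 1)\<^sup>2 + (y $ 2)\<^sup>2"
    by (simp only: sin_cos_squared_add mult_1_right)
  moreover have "(norm y)\<^sup>2 = (y $ 1)\<^sup>2 + (y $ 2)\<^sup>2"
    unfolding power2_norm_eq_inner by (simp add: inner_vec_def sum_2 power2_eq_square)
  ultimately have "(norm y)\<^sup>2 = p\<^sup>2 + q\<^sup>2" by simp
  also have "\<dots> \<le> (a / 2)\<^sup>2 + (a / 2)\<^sup>2"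
    using p q assms by (intro add_mono) (auto intro!: abs_le_square_iff[THEN iffD1])
  also have "\<dots> \<le> a\<^sup>2"
    by (simp add: power2_eq_square)
  finally have "norm y \<le> a"
    by (rule power2_le_imp_le) (use assms in linarith)
  then show "x \<in> cball c a"
    by (simp add: y_def dist_norm norm_minus_commute)
qed

lemma differentiation_basis_rectangle_basis:
  assumes "\<Theta> \<noteq> {}" and "\<And>t. t \<in> \<Theta> \<Longrightarrow> 1 \<le> \<sigma> t"
  shows "differentiation_basis (rectangle_basis \<Theta> \<sigma>)"
  unfolding differentiation_basis_def
proof (intro conjI allI impI ballI)
  show "open B" if "B \<in> rectangle_basis \<Theta> \<sigma>" for B
    using that by (auto simp: rectangle_basis_def open_rect)
next
  fix x :: "real^2" and \<epsilon> :: real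
  assume \<epsilon>: "0 < \<epsilon>"
  obtain t where t: "t \<in> \<Theta>" using assms(1) by blast
  have s: "1 \<le> \<sigma> t" using assms(2) t .
  define b where "b = \<epsilon> / (3 * \<sigma> t)"
  define a where "a = b * \<sigma> t"
  have b: "0 < b" using \<epsilon> s by (simp add: b_def)
  have ba: "b \<le> a" using b s by (simp add: a_def)
  have a: "a = \<epsilon> / 3" using s by (simp add: a_def b_def)
  let ?B = "rect x t a b"
  have sub: "?B \<subseteq> cball x a" using rect_subset_cball[OF b ba] .
  have "diameter ?B \<le> diameter (cball x a)" by (rule diameter_subset[OF sub bounded_cball])
  then have "diameter ?B < \<epsilon>" using \<epsilon> unfolding a by simp
  moreover have "bounded ?B" using bounded_subset[OF bounded_cball sub] .
  moreover have "x \<in> ?B" using b ba by (simp add: rect_def)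
  moreover have "?B \<in> rectangle_basis \<Theta> \<sigma>"
    using b ba t unfolding rectangle_basis_def a_def by fastforce
  ultimately show "\<exists>B\<in>rectangle_basis \<Theta> \<sigma>. x \<in> B \<and> bounded B \<and> diameter B < \<epsilon>" by blast
qed

text \<open>An angle determines its level, so prescribing the shape \<open>level_shape N k\<close> at every
  \<open>angle N k i\<close> is a consistent definition of a function on \<open>angle_set N\<close>.\<close>

lemma angle_bounds:
  assumes "1 \<le> i" "i \<le> N k"
  shows "theta (k + 1) \<le> angle N k i" "angle N k i < theta k"
proof -
  have d: "0 < theta k - theta (k + 1)" by (simp add: theta_def field_simps)
  have f: "0 \<le> (real i - 1) / real (N k)" "(real i - 1) / real (N k) < 1"
    using assms by (auto simp: field_simps)
  show "theta (k + 1) \<le> angle N k i" using mult_nonneg_nonneg[OF f(1), of "theta k - theta (k + 1)"] d by (simp add: angle_def)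
  show "angle N k i < theta k"
    using mult_strict_right_mono[OF f(2) d] by (simp add: angle_def)
qed

lemma angle_eq_imp_level_eq:
  assumes "1 \<le> i" "i \<le> N k" "1 \<le> j" "j \<le> N l" "angle N k i = angle N l j"
  shows "k = l"
proof -
  have anti: "theta n \<le> theta m" if "m \<le> n" for m n
    using that by (simp add: theta_def frac_le)
  show ?thesis
    using angle_bounds[of i N k] angle_bounds[of j N l] assms
      anti[of "k + 1" l] anti[of "l + 1" k]
    by (cases k l rule: linorder_cases) auto
qed

lemma level_shape_ge_1:
  assumes "0 < N k"
  shows "1 \<le> level_shape N k"
proof -
  define u where "u = (1 / 2 ^ (k + 1)) / real (N k)"
  have "1 \<le> 2 ^ (k + 1) * real (N k)"
    using mult_mono[of 1 "2 ^ (k + 1)" 1 "real (N k)"] assms by (simp add: one_le_power del: power_Suc)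
  then have "0 < u" "u \<le> 1"
    using assms by (simp_all add: u_def divide_simps)
  then have "0 < sin u"
    using pi_gt3 by (intro sin_gt_zero) auto
  moreover have "sin u \<le> 4" by (rule order_trans[OF sin_le_one]) simp
  ultimately have "1 \<le> 4 / sin u" by simp
  then show ?thesis unfolding level_shape_def u_def .
qed

end

theory Submission
  imports Defs "HOL-Real_Asymp.Real_Asymp"
begin

text \<open>Write \<open>D = 2 ^ -(k + 1) / N k\<close> for the angular gap at level \<open>k\<close>. At scale \<open>1 / R\<close> put a ball of
  radius \<open>D / R\<close> around each point of a lattice of spacings about \<open>1 / R\<close> and \<open>2 ^ -k / R\<close>, and let
  \<open>f\<close> have height \<open>16 M / D\<close> there. From every point \<open>x\<close> of the unit square, the sector of
  directions of level \<open>k\<close> contains a lattice point at distance at most \<open>1 / (4 R)\<close>. Some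
  prescribed direction deviates from it by at most \<open>D\<close>, so the rectangle of that direction and of length
  \<open>1 / R\<close> centred at \<open>x\<close> meets the ball in a fixed fraction of \<open>D\<^sup>2 / R\<^sup>2\<close>; as its area is about
  \<open>D / R\<^sup>2\<close>, the average of \<open>f\<close> over it is at least \<open>M\<close>. The Orlicz mass of \<open>f\<close> is of order
  \<open>M * (1 + (ln M + k + ln (N k)) powr \<alpha>) / N k\<close>, independently of \<open>R\<close>, and tends to \<open>0\<close>
  with \<open>k\<close> for fixed \<open>M\<close>. So let \<open>M\<close> and \<open>R\<close> tend to infinity with summable masses: the
  supremum of these functions lies in the Orlicz space, and its averages are unbounded near every point of the
  square.\<close>

section \<open>Areas of balls and rectangles, and lower bounds for averages\<close>

lemma measure_ball_vec2:
  fixes c :: "real^2"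
  assumes "0 \<le> r"
  shows "measure lebesgue (ball c r) = pi * r\<^sup>2"
  using content_ball[OF assms, of c] by (simp add: unit_ball_vol_2)

text \<open>The rectangle is the image of an axis-parallel box centred at the origin under the
  rotation by \<open>t\<close>, followed by the translation by \<open>c\<close>; both maps preserve
  measurability and area.\<close>

lemma
  fixes c :: "real^2"
  assumes "0 < a" "0 < b"
  shows lmeasurable_rect: "rect c t a b \<in> lmeasurable"
    and measure_rect: "measure lebesgue (rect c t a b) = a * b"
proof -
  define f :: "real^2 \<Rightarrow> real^2"
    where "f y = vector [y$1 * cos t - y$2 * sin t, y$1 * sin t + y$2 * cos t]" for y
  define S :: "(real^2) set" where "S = box (vector [-a/2, -b/2]) (vector [a/2, b/2])"
  have sc: "cos t * cos t + sin t * sin t = 1"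
    using sin_cos_squared_add3 by auto
  have lin: "linear f"
    by (rule linearI) (auto simp: f_def vec_eq_iff forall_2 algebra_simps)
  have "f v \<bullet> f w = v \<bullet> w" for v w
  proof -
    have "f v \<bullet> f w = (v \<bullet> w) * (cos t * cos t + sin t * sin t)"
      by (simp add: f_def inner_vec_def sum_2 algebra_simps del: sin_cos_squared_add3)
    then show ?thesis by (simp add: sc)
  qed
  with lin have orth: "orthogonal_transformation f"
    by (simp add: orthogonal_transformation_def)
  have rot: "f y \<bullet> vector [cos t, sin t] = y$1" "f y \<bullet> vector [- sin t, cos t] = y$2" for y
  proof -
    have "f y \<bullet> vector [cos t, sin t] = y$1 * (cos t * cos t + sin t * sin t)"
      "f y \<bullet> vector [- sin t, cos t] = y$2 * (cos t * cos t + sin t * sin t)"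
      by (simp_all add: f_def inner_vec_def sum_2 algebra_simps del: sin_cos_squared_add3)
    then show "f y \<bullet> vector [cos t, sin t] = y$1" "f y \<bullet> vector [- sin t, cos t] = y$2"
      by (simp_all add: sc)
  qed
  have surj: "surj f"
    using orth orthogonal_transformation_surj by blast
  have S: "y \<in> S \<longleftrightarrow> \<bar>y$1\<bar> < a/2 \<and> \<bar>y$2\<bar> < b/2" for y
    by (auto simp: S_def mem_box_cart forall_2)
  have eq: "rect c t a b = (+) c ` f ` S"
  proof (intro equalityI subsetI)
    fix x assume x: "x \<in> rect c t a b"
    obtain y where y: "x - c = f y" using surj by (metis surjD)
    have "y \<in> S" using x unfolding rect_def S y mem_Collect_eq rot by simp
    moreover have "x = c + f y" using y by (simp add: algebra_simps)
    ultimately show "x \<in> (+) c ` f ` S" by blast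
  next
    fix x assume "x \<in> (+) c ` f ` S"
    then obtain y where "y \<in> S" "x = c + f y" by blast
    then show "x \<in> rect c t a b" by (simp add: rect_def rot S)
  qed
  have Sm: "S \<in> lmeasurable" by (simp add: S_def)
  show "rect c t a b \<in> lmeasurable"
    unfolding eq by (intro measurable_translation measurable_orthogonal_image orth Sm)
  have "measure lebesgue S = measure lebesgue (cbox (vector [-a/2, -b/2] :: real^2) (vector [a/2, b/2]))"
    unfolding S_def by (simp add: measure_lborel_box_eq measure_lborel_cbox_eq)
  also have "\<dots> = a * b"
  proof -
    have "cbox (vector [-a/2, -b/2] :: real^2) (vector [a/2, b/2]) \<noteq> {}"
      using assms by (simp add: interval_ne_empty_cart forall_2)
    then show ?thesis
      using content_cbox_cart[of "vector [-a/2, -b/2] :: real^2" "vector [a/2, b/2]"]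
      by (simp add: UNIV_2)
  qed
  finally have "measure lebesgue S = a * b" .
  then show "measure lebesgue (rect c t a b) = a * b"
    unfolding eq measure_translation measure_orthogonal_image[OF orth Sm] .
qed

text \<open>In the rotated frame at \<open>c\<close> the centre of the ball has coordinates
  \<open>(\<rho>, 0)\<close>. By Cauchy-Schwarz each coordinate changes by less than
  \<open>s\<close> within the ball.\<close>

lemma ball_subset_rect:
  assumes "0 \<le> \<rho>" "\<rho> + s \<le> a / 2" "s \<le> b / 2"
  shows "ball (c + \<rho> *\<^sub>R vector [cos t, sin t]) s \<subseteq> rect c t a b"
proof
  fix y assume y: "y \<in> ball (c + \<rho> *\<^sub>R vector [cos t, sin t]) s"
  define z where "z = y - (c + \<rho> *\<^sub>R vector [cos t, sin t])"
  have z: "norm z < s" using y by (simp add: z_def dist_norm norm_minus_commute)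
  have sc: "cos t * cos t + sin t * sin t = 1"
    using sin_cos_squared_add3 by auto
  have n: "norm (vector [cos t, sin t] :: real^2) = 1" "norm (vector [- sin t, cos t] :: real^2) = 1"
    by (simp_all add: norm_eq_sqrt_inner inner_vec_def sum_2 sc add.commute)
  have yc: "y - c = z + \<rho> *\<^sub>R vector [cos t, sin t]" by (simp add: z_def algebra_simps)
  have "(vector [cos t, sin t] :: real^2) \<bullet> vector [cos t, sin t] = 1"
    "(vector [cos t, sin t] :: real^2) \<bullet> vector [- sin t, cos t] = 0"
    by (simp_all add: inner_vec_def sum_2 sc)
  then have "(y - c) \<bullet> vector [cos t, sin t] = z \<bullet> vector [cos t, sin t] + \<rho>"
    "(y - c) \<bullet> vector [- sin t, cos t] = z \<bullet> vector [- sin t, cos t]"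
    unfolding yc by (simp_all add: inner_add_left)
  moreover have "\<bar>z \<bullet> vector [cos t, sin t]\<bar> < s" "\<bar>z \<bullet> vector [- sin t, cos t]\<bar> < s"
    using Cauchy_Schwarz_ineq2[of z "vector [cos t, sin t]"]
      Cauchy_Schwarz_ineq2[of z "vector [- sin t, cos t]"] n z by simp_all
  ultimately show "y \<in> rect c t a b"
    unfolding rect_def mem_Collect_eq using assms by (intro conjI; linarith)
qed

text \<open>Chebyshev's inequality: since \<open>f\<close> is nonnegative, the part of the integral
  over \<open>S\<close> bounds the integral over \<open>B\<close> from below. The bound on
  \<open>S\<close> is asked only almost everywhere, as \<open>LlogL_supremum\<close> provides
  it.\<close>

lemma average_ge:
  fixes f :: "real^2 \<Rightarrow> real"
  assumes "integrable lebesgue f" "\<And>x. 0 \<le> f x" "AE x in lebesgue. x \<in> S \<longrightarrow> h \<le> f x" "0 \<le> h"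
    and "S \<in> lmeasurable" "B \<in> lmeasurable" "S \<subseteq> B"
  shows "h * measure lebesgue S / measure lebesgue B \<le> average f B"
proof -
  have "h * measure lebesgue S = (LINT x|lebesgue. h * indicator S x)"
    using assms(5) by (simp add: fmeasurableD)
  also have "\<dots> \<le> (LINT x|lebesgue. indicator B x *\<^sub>R f x)"
  proof (rule integral_mono_AE)
    show "integrable lebesgue (\<lambda>x. h * indicator S x)"
      using assms(5) by (intro integrable_mult_right) (auto simp: fmeasurable_def)
    show "integrable lebesgue (\<lambda>x. indicator B x *\<^sub>R f x)"
      using assms(1,6) by (intro integrable_mult_indicator) auto
    show "AE x in lebesgue. h * indicator S x \<le> indicator B x *\<^sub>R f x"
      using assms(3) by eventually_elim (use assms(2,4,7) in \<open>auto simp: indicator_def\<close>)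
  qed
  finally have "h * measure lebesgue S \<le> (LINT x:B|lebesgue. f x)"
    by (simp add: set_lebesgue_integral_def)
  then show ?thesis
    unfolding average_def by (simp add: divide_right_mono)
qed

section \<open>Suprema of step functions in the Orlicz space\<close>

definition orlicz :: "real \<Rightarrow> real \<Rightarrow> real" where
  "orlicz \<alpha> t = t * (1 + log_plus t powr \<alpha>)"

lemma orlicz_ge: "0 \<le> t \<Longrightarrow> t \<le> orlicz \<alpha> t"
  by (simp add: orlicz_def algebra_simps)

text \<open>Take \<open>f\<close> to be the pointwise supremum of the functions equal to
  \<open>h j\<close> on \<open>A j\<close> and \<open>0\<close> elsewhere. Almost everywhere it is
  \<open>0\<close> or one of the \<open>h j\<close> with \<open>x\<close> in \<open>A j\<close>, so
  its Orlicz integrand is at most the sum of the individual ones. A sum of bumps would instead call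
  for an estimate of the Orlicz function at sums.\<close>

lemma LlogL_supremum:
  fixes h :: "nat \<Rightarrow> real" and A :: "nat \<Rightarrow> (real^2) set"
  assumes h: "\<And>j. 1 \<le> h j" and A: "\<And>j. A j \<in> lmeasurable"
    and summ: "summable (\<lambda>j. orlicz \<alpha> (h j) * measure lebesgue (A j))"
  obtains f where "f \<in> LlogL \<alpha>" "\<And>x. 0 \<le> f x" "integrable lebesgue f"
    "AE x in lebesgue. \<forall>j. x \<in> A j \<longrightarrow> h j \<le> f x"
proof -
  have h0: "0 \<le> h j" for j using h[of j] by linarith
  have \<Phi>1: "1 \<le> orlicz \<alpha> (h j)" for j
    using orlicz_ge[OF h0[of j], of \<alpha>] h[of j] by linarith
  have [measurable]: "A j \<in> sets lebesgue" for j using A by (simp add: fmeasurableD)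
  \<comment> \<open>The supremum always exists in \<open>ennreal\<close>. Passing to reals replaces
    the value infinity by 0, but \<open>g\<close> can be infinite only where infinitely many
    \<open>A j\<close> overlap, which is a null set.\<close>
  define g where "g x = (SUP j. ennreal (h j) * indicator (A j) x)" for x
  define f where "f x = enn2real (g x)" for x
  have g_meas [measurable]: "g \<in> borel_measurable lebesgue"
    unfolding g_def by measurable
  have f_meas [measurable]: "f \<in> borel_measurable lebesgue"
    unfolding f_def by measurable
  \<comment> \<open>Because \<open>h j\<close> is at least 1, so is its Orlicz value, and the masses
    dominate the measures. Borel-Cantelli then applies.\<close>
  have "summable (\<lambda>j. measure lebesgue (A j))"
    by (rule summable_comparison_test'[OF summ, of 0])
      (use \<Phi>1 in \<open>auto simp: mult_le_cancel_right1 intro: order_trans[OF _ mult_right_mono[OF \<Phi>1]]\<close>)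
  then have "AE x in lebesgue. eventually (\<lambda>j. x \<in> space lebesgue - A j) sequentially"
    using A by (intro borel_cantelli_AE1) (auto simp: fmeasurable_def)
  then have fin: "AE x in lebesgue. finite {j. x \<in> A j}"
  proof eventually_elim
    case (elim x)
    then obtain n where "\<And>j. j \<ge> n \<Longrightarrow> x \<notin> A j"
      by (auto simp: eventually_sequentially)
    then have "{j. x \<in> A j} \<subseteq> {..<n}" by (metis (lifting) linorder_not_le lessThan_iff mem_Collect_eq subsetI)
    then show ?case using finite_subset by blast
  qed
  \<comment> \<open>Where finitely many \<open>A j\<close> overlap, the supremum is over a finite
    set of values and hence attained.\<close>
  have key: "(\<forall>j. x \<in> A j \<longrightarrow> h j \<le> f x) \<and> (f x = 0 \<or> (\<exists>j. x \<in> A j \<and> f x = h j))"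
    if "finite {j. x \<in> A j}" for x
  proof -
    let ?S = "range (\<lambda>j. ennreal (h j) * indicator (A j) x)"
    have "?S \<subseteq> insert 0 ((\<lambda>j. ennreal (h j)) ` {j. x \<in> A j})"
      by (auto simp: indicator_def)
    then have "finite ?S" using that by (meson finite_imageI finite_insert finite_subset)
    then have "g x \<in> ?S" unfolding g_def
      by (rule finite_Sup_in) (auto simp: sup_max max_def)
    then obtain j where j: "g x = ennreal (h j) * indicator (A j) x" by blast
    have fin: "g x < \<infinity>" unfolding j by (simp add: indicator_def)
    have "h i \<le> f x" if "x \<in> A i" for i
    proof -
      have "ennreal (h i) * indicator (A i) x \<le> g x" unfolding g_def by (rule SUP_upper) simp
      then have "ennreal (h i) \<le> ennreal (f x)" using fin that by (simp add: f_def)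
      then show ?thesis by (simp add: f_def)
    qed
    moreover have "f x = 0 \<or> (\<exists>j. x \<in> A j \<and> f x = h j)"
      unfolding f_def j using h0[of j] by (cases "x \<in> A j") auto
    ultimately show ?thesis by blast
  qed
  have f0: "0 \<le> f x" for x by (simp add: f_def)
  have "(\<integral>\<^sup>+x. ennreal (\<bar>f x\<bar> * (1 + log_plus \<bar>f x\<bar> powr \<alpha>)) \<partial>lebesgue)
      \<le> (\<integral>\<^sup>+x. (\<Sum>j. ennreal (orlicz \<alpha> (h j)) * indicator (A j) x) \<partial>lebesgue)"
  proof (rule nn_integral_mono_AE)
    show "AE x in lebesgue. ennreal (\<bar>f x\<bar> * (1 + log_plus \<bar>f x\<bar> powr \<alpha>))
      \<le> (\<Sum>j. ennreal (orlicz \<alpha> (h j)) * indicator (A j) x)"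
      using fin
    proof eventually_elim
      case (elim x)
      from key[OF this] consider "f x = 0" | j where "x \<in> A j" "f x = h j" by blast
      then show ?case
      proof cases
        case 2
        have "ennreal (\<bar>f x\<bar> * (1 + log_plus \<bar>f x\<bar> powr \<alpha>)) = ennreal (orlicz \<alpha> (h j)) * indicator (A j) x"
          using 2 h0[of j] by (simp add: orlicz_def)
        also have "\<dots> \<le> (\<Sum>j. ennreal (orlicz \<alpha> (h j)) * indicator (A j) x)"
        proof -
          define w where "w = (\<lambda>j. ennreal (orlicz \<alpha> (h j)) * indicator (A j) x)"
          have "w j \<le> suminf w"
            using sum_le_suminf[of w "{j}"] by simp
          then show ?thesis by (simp add: w_def)
        qed
        finally show ?thesis .
      qed simp
    qed
  qed
  also have "\<dots> = (\<Sum>j. \<integral>\<^sup>+x. ennreal (orlicz \<alpha> (h j)) * indicator (A j) x \<partial>lebesgue)"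
    by (rule nn_integral_suminf) measurable
  also have "\<dots> = (\<Sum>j. ennreal (orlicz \<alpha> (h j) * measure lebesgue (A j)))"
  proof (rule arg_cong[where f = suminf], rule ext)
    fix j
    have "emeasure lebesgue (A j) = ennreal (measure lebesgue (A j))"
      using A[of j] by (simp add: emeasure_eq_measure2)
    then show "(\<integral>\<^sup>+x. ennreal (orlicz \<alpha> (h j)) * indicator (A j) x \<partial>lebesgue)
        = ennreal (orlicz \<alpha> (h j) * measure lebesgue (A j))"
      using \<Phi>1[of j] by (simp add: nn_integral_cmult ennreal_mult)
  qed
  also have "\<dots> < \<infinity>"
    using summ by (subst suminf_ennreal2) (auto intro!: mult_nonneg_nonneg order_trans[OF zero_le_one \<Phi>1])
  finally have *: "(\<integral>\<^sup>+x. ennreal (\<bar>f x\<bar> * (1 + log_plus \<bar>f x\<bar> powr \<alpha>)) \<partial>lebesgue) < \<infinity>" .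
  then have L: "f \<in> LlogL \<alpha>" by (simp add: LlogL_def)
  have "(\<integral>\<^sup>+x. ennreal (norm (f x)) \<partial>lebesgue)
      \<le> (\<integral>\<^sup>+x. ennreal (\<bar>f x\<bar> * (1 + log_plus \<bar>f x\<bar> powr \<alpha>)) \<partial>lebesgue)"
    using orlicz_ge[of "\<bar>f x\<bar>" \<alpha> for x] by (intro nn_integral_mono ennreal_leI) (simp add: orlicz_def)
  with * have "integrable lebesgue f"
    by (intro integrableI_bounded) auto
  moreover have "AE x in lebesgue. \<forall>j. x \<in> A j \<longrightarrow> h j \<le> f x"
    using fin by eventually_elim (use key in blast)
  ultimately show thesis using that L f0 by blast
qed

subsection \<open>The lattice of bumps\<close>

lemma abs_sin_diff_le: "\<bar>sin x - sin y\<bar> \<le> \<bar>x - y\<bar>" for x y :: real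
proof -
  have "\<bar>sin x - sin y\<bar> = 2 * \<bar>sin ((x - y) / 2)\<bar> * \<bar>cos ((x + y) / 2)\<bar>"
    by (simp add: sin_diff_sin abs_mult)
  also have "\<dots> \<le> 2 * \<bar>(x - y) / 2\<bar> * 1"
    by (intro mult_mono abs_sin_x_le_abs_x abs_cos_le_one) auto
  finally show ?thesis by simp
qed

lemma abs_cos_diff_le: "\<bar>cos x - cos y\<bar> \<le> \<bar>x - y\<bar>" for x y :: real
  using abs_sin_diff_le[of "pi/2 - x" "pi/2 - y"] by (simp add: sin_diff)

text \<open>Mean value theorem: the derivative \<open>1 / cos^2\<close> of the tangent is at least
  1. This bounds the vertical sections of a sector from below by its opening angle.\<close>

lemma tan_diff_ge:
  fixes x y :: real
  assumes "0 \<le> x" "x < y" "y < pi / 2"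
  shows "y - x \<le> tan y - tan x"
proof -
  have pos: "0 < cos z" if "x \<le> z" "z \<le> y" for z
    using that assms by (intro cos_gt_zero_pi) auto
  obtain z where z: "x < z" "z < y" "tan y - tan x = (y - x) * inverse ((cos z)\<^sup>2)"
    using MVT2[OF assms(2), of tan "\<lambda>z. inverse ((cos z)\<^sup>2)"] pos DERIV_tan
    by (metis less_numeral_extra(3))
  have "(cos z)\<^sup>2 \<le> 1" "0 < (cos z)\<^sup>2"
    using pos[of z] z by (auto simp: abs_square_le_1)
  then have "1 \<le> inverse ((cos z)\<^sup>2)" by (simp add: one_le_inverse)
  then show ?thesis
    using assms(2) mult_left_mono[of 1 "inverse ((cos z)\<^sup>2)" "y - x"] z(3) by simp
qed

lemma cos_ge_half: "1 / 2 \<le> cos x" if "0 \<le> x" "x \<le> 1" for x :: real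
  using cos_monotone_0_pi_le[of x "pi / 3"] that pi_gt3 by (simp add: cos_60)

lemma sin_ge_half:
  fixes x :: real
  assumes "0 < x" "x \<le> 1"
  shows "x / 2 \<le> sin x"
proof -
  obtain z where z: "0 < z" "z < x" "sin x - sin 0 = (x - 0) * cos z"
    using MVT2[OF assms(1), of sin cos] DERIV_sin by blast
  then show ?thesis
    using mult_left_mono[OF cos_ge_half[of z], of x] assms by simp
qed

section \<open>The angles of one level and their gap\<close>

lemma theta_pos: "0 < theta k" and theta_le_1: "theta k \<le> 1"
  by (simp_all add: theta_def)

lemma theta_Suc: "theta k = 2 * theta (k + 1)"
  by (simp add: theta_def)

text \<open>Since \<open>theta k - theta (k + 1) = theta (k + 1)\<close>, this is the distance
  between consecutive angles of level \<open>k\<close>. It is also the argument of the sine in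
  \<open>level_shape\<close>.\<close>

definition gap :: "(nat \<Rightarrow> nat) \<Rightarrow> nat \<Rightarrow> real" where
  "gap N k = theta (k + 1) / real (N k)"

lemma angle_eq_gap: "angle N k i = theta (k + 1) + (real i - 1) * gap N k"
  using theta_Suc[of k] by (simp add: angle_def gap_def)

lemma level_shape_eq_gap: "level_shape N k = 4 / sin (gap N k)"
  by (simp add: level_shape_def gap_def theta_def)

lemma gap_pos: "0 < N k \<Longrightarrow> 0 < gap N k"
  by (simp add: gap_def theta_pos)

lemma gap_le_half: "gap N k \<le> 1 / 2" if "0 < N k"
proof -
  have "gap N k \<le> theta (k + 1) / 1"
    unfolding gap_def using that theta_pos[of "k + 1"] by (intro divide_left_mono) auto
  then show ?thesis using theta_Suc[of k] theta_le_1[of k] by simp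
qed

text \<open>The angles of level \<open>k\<close> form a grid of step \<open>gap N k\<close> starting
  at \<open>theta (k + 1)\<close>, and \<open>\<phi>\<close> is rounded down to it. The grid stops
  one step before \<open>theta k\<close>, so the strict bound on \<open>\<phi>\<close> keeps the
  index within \<open>N k\<close>.\<close>

lemma nearest_angle:
  assumes "0 < N k" "theta (k + 1) \<le> \<phi>" "\<phi> < theta k"
  obtains i where "1 \<le> i" "i \<le> N k" "\<bar>\<phi> - angle N k i\<bar> \<le> gap N k"
proof -
  define q where "q = (\<phi> - theta (k + 1)) / gap N k"
  have D: "0 < gap N k" using gap_pos assms(1) .
  have q0: "0 \<le> q" using assms(2) D by (simp add: q_def)
  have "q < real (N k)"
    using assms theta_Suc[of k] theta_pos[of "k + 1"] unfolding q_def gap_def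
    by (simp add: divide_simps)
  then have "nat \<lfloor>q\<rfloor> + 1 \<le> N k" using q0 by linarith
  moreover have "\<bar>\<phi> - angle N k (nat \<lfloor>q\<rfloor> + 1)\<bar> \<le> gap N k"
  proof -
    have "\<phi> - angle N k (nat \<lfloor>q\<rfloor> + 1) = (q - of_int \<lfloor>q\<rfloor>) * gap N k"
    proof -
      have "q * gap N k = \<phi> - theta (k + 1)" using D by (simp add: q_def)
      then show ?thesis using q0 by (simp add: angle_eq_gap left_diff_distrib)
    qed
    moreover have "0 \<le> q - of_int \<lfloor>q\<rfloor>" "q - of_int \<lfloor>q\<rfloor> \<le> 1" by linarith+
    ultimately show ?thesis using D by (simp add: abs_mult mult_le_cancel_right1)
  qed
  ultimately show thesis using that[of "nat \<lfloor>q\<rfloor> + 1"] by simp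
qed

text \<open>The vertical spacing is \<open>theta (k + 1) / (16 R)\<close>. At horizontal distance at least
  \<open>1 / (16 R)\<close> from its apex, the sector of directions between \<open>theta (k + 1)\<close> and \<open>theta k\<close> has
  vertical sections at least that long, so it cannot avoid the lattice.\<close>

definition bump_centre :: "nat \<Rightarrow> nat \<Rightarrow> nat \<Rightarrow> nat \<Rightarrow> real^2" where
  "bump_centre k R m n = vector [real m / (16 * real R), real n / (32 * real R * 2 ^ k)]"

lemma bump_centre_in_sector:
  fixes x :: "real^2"
  assumes "0 \<le> x$1" "x$1 \<le> 1" "0 \<le> x$2" "x$2 \<le> 1" "1 \<le> R"
  obtains m n \<phi> \<rho> where "m \<le> 32 * R" "n \<le> 64 * R * 2 ^ k" "theta (k + 1) \<le> \<phi>" "\<phi> < theta k"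
    "0 \<le> \<rho>" "\<rho> \<le> 1 / (4 * real R)" "bump_centre k R m n = x + \<rho> *\<^sub>R vector [cos \<phi>, sin \<phi>]"
proof -
  have R: "1 \<le> real R" using assms by simp
  \<comment> \<open>Adding 2 to the floor places the column strictly more than one and at most two
    horizontal spacings to the right of \<open>x\<close>. The first bound makes the section of the
    sector long enough, the second keeps the point near.\<close>
  define m where "m = nat \<lfloor>16 * real R * x$1\<rfloor> + 2"
  define u where "u = real m / (16 * real R) - x$1"
  have p0: "0 \<le> 16 * real R * x$1" using assms by simp
  then have m: "16 * real R * x$1 + 1 < real m" "real m \<le> 16 * real R * x$1 + 2"
    unfolding m_def by linarith+
  have u: "1 / (16 * real R) < u" "u \<le> 1 / (8 * real R)"
  proof -
    have "u = (real m - 16 * real R * x$1) / (16 * real R)" using R by (simp add: u_def field_simps)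
    moreover have "1 / (16 * real R) < (real m - 16 * real R * x$1) / (16 * real R)"
      "(real m - 16 * real R * x$1) / (16 * real R) \<le> 2 / (16 * real R)"
      using m R by (intro divide_strict_right_mono divide_right_mono; simp)+
    ultimately show "1 / (16 * real R) < u" "u \<le> 1 / (8 * real R)" by simp_all
  qed
  have upos: "0 < u" using u(1) R by (meson divide_pos_pos less_trans less_le_trans mult_pos_pos zero_less_numeral zero_less_one)
  have "16 * real R * x$1 \<le> 16 * real R" using assms R by (simp add: mult_left_le)
  then have mR: "m \<le> 32 * R" using m(2) assms(5) by linarith
  have pi: "theta k < pi / 2" "theta (k + 1) < pi / 2"
    using theta_le_1[of k] theta_le_1[of "k + 1"] pi_gt3 by linarith+
  note tp = theta_pos[of k] theta_pos[of "k + 1"]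
  \<comment> \<open>Slopes of the two edges: at horizontal distance \<open>u\<close> the sector
    occupies the relative heights from \<open>u * T1\<close> to \<open>u * T2\<close>.\<close>
  define T1 T2 where "T1 = tan (theta (k + 1))" and "T2 = tan (theta k)"
  have T: "theta (k + 1) \<le> T2 - T1" "0 < T1"
    using tan_diff_ge[of "theta (k + 1)" "theta k"] theta_Suc[of k] tp pi tan_gt_zero[of "theta (k + 1)"]
    by (simp_all add: T1_def T2_def)
  define s where "s = 1 / (32 * real R * 2 ^ k)"
  have s: "0 < s" using R by (simp add: s_def)
  have "s = 1 / (16 * real R) * theta (k + 1)" by (simp add: s_def theta_def)
  also have "\<dots> < u * theta (k + 1)" using u(1) tp(2) by (rule mult_strict_right_mono)
  also have "\<dots> \<le> u * (T2 - T1)" using T(1) upos by simp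
  finally have sT: "s < u * T2 - u * T1" by (simp add: algebra_simps)
  \<comment> \<open>The lowest lattice point of the column on or above the lower edge; as the
    section is longer than \<open>s\<close>, it is still below the upper edge.\<close>
  define n where "n = nat \<lceil>(x$2 + u * T1) / s\<rceil>"
  define v where "v = real n * s - x$2"
  have "0 \<le> (x$2 + u * T1) / s" using assms upos T s by simp
  then have "(x$2 + u * T1) / s \<le> real n" "real n < (x$2 + u * T1) / s + 1"
    unfolding n_def by linarith+
  then have v: "u * T1 \<le> v" "v < u * T2"
    using s sT by (simp_all add: v_def field_simps)
  define \<phi> where "\<phi> = arctan (v / u)"
  have tn: "tan \<phi> = v / u" by (simp add: \<phi>_def tan_arctan)
  have "T1 \<le> v / u" "v / u < T2" using v upos by (simp_all add: field_simps)
  then have "arctan T1 \<le> \<phi>" "\<phi> < arctan T2" by (simp_all add: \<phi>_def arctan_le_iff arctan_less_iff)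
  then have \<phi>: "theta (k + 1) \<le> \<phi>" "\<phi> < theta k"
    using pi tp by (simp_all add: T1_def T2_def arctan_tan)
  \<comment> \<open>As \<open>\<phi>\<close> is below 1, the distance \<open>\<rho>\<close> is at
    most \<open>2 * u\<close>, hence at most \<open>1 / (4 R)\<close>.\<close>
  then have c: "1 / 2 \<le> cos \<phi>" using tp theta_le_1[of k] by (intro cos_ge_half) auto
  define \<rho> where "\<rho> = u / cos \<phi>"
  have \<rho>c: "\<rho> * cos \<phi> = u" using c by (auto simp: \<rho>_def)
  have \<rho>s: "\<rho> * sin \<phi> = v" using tn upos by (simp add: \<rho>_def tan_def field_simps)
  have \<rho>0: "0 \<le> \<rho>" using c upos by (simp add: \<rho>_def)
  have "\<rho> \<le> u / (1 / 2)" unfolding \<rho>_def using c upos by (intro divide_left_mono) auto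
  also have "\<dots> = 2 * u" by simp
  also have "\<dots> \<le> 2 * (1 / (8 * real R))" using u(2) by (intro mult_left_mono) auto
  finally have "\<rho> \<le> 2 * (1 / (8 * real R))" .
  then have \<rho>: "\<rho> \<le> 1 / (4 * real R)" by simp
  \<comment> \<open>The lattice point has height \<open>x$2 + v\<close>, at most 2, which bounds the
    row index.\<close>
  have "v \<le> \<rho>" using \<rho>s \<rho>0 by (metis mult.right_neutral mult_left_mono sin_le_one)
  moreover have "1 / (4 * real R) \<le> 1" using R by (simp add: field_simps)
  ultimately have "real n * s \<le> 2" using assms(4) \<rho> by (simp add: v_def)
  then have "real n \<le> 64 * real R * 2 ^ k" using R by (simp add: s_def field_simps)
  then have "real n \<le> real (64 * R * 2 ^ k)" by simp
  then have nR: "n \<le> 64 * R * 2 ^ k" by (simp only: of_nat_le_iff)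
  have "bump_centre k R m n = x + \<rho> *\<^sub>R vector [cos \<phi>, sin \<phi>]"
    by (simp add: bump_centre_def vec_eq_iff forall_2 \<rho>c \<rho>s u_def v_def s_def)
  then show thesis using that mR nR \<phi> \<rho>0 \<rho> by blast
qed

text \<open>The index ranges are those that \<open>bump_centre_in_sector\<close> yields for points
  of the unit square, so one finite union serves all of them.\<close>

definition bumps :: "real \<Rightarrow> nat \<Rightarrow> nat \<Rightarrow> (real^2) set" where
  "bumps D k R = (\<Union>(m, n) \<in> {..32 * R} \<times> {..64 * R * 2 ^ k}. ball (bump_centre k R m n) (D / real R))"

lemma lmeasurable_bumps: "bumps D k R \<in> lmeasurable"
  unfolding bumps_def by (rule fmeasurable.finite_UN) auto

text \<open>Turning the direction \<open>\<phi>\<close> into the nearest prescribed one changes sine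
  and cosine by at most the gap \<open>D\<close> each, so it moves the point at distance
  \<open>\<rho>\<close> by at most \<open>2 * D * \<rho>\<close>, thus by at most
  \<open>D / (2 R)\<close>. Within the bump of radius \<open>D / R\<close> this leaves room for a
  ball of radius \<open>sin D / (8 R)\<close>, which is half the short side of the rectangle in
  \<open>large_average\<close>.\<close>

lemma ball_subset_bumps:
  fixes x :: "real^2"
  assumes "0 \<le> x$1" "x$1 \<le> 1" "0 \<le> x$2" "x$2 \<le> 1" "1 \<le> R" "0 < N k"
  obtains i \<rho> where "1 \<le> i" "i \<le> N k" "0 \<le> \<rho>" "\<rho> \<le> 1 / (4 * real R)"
    "ball (x + \<rho> *\<^sub>R vector [cos (angle N k i), sin (angle N k i)]) (sin (gap N k) / (8 * real R))
       \<subseteq> bumps (gap N k) k R"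
proof -
  obtain m n \<phi> \<rho> where mn: "m \<le> 32 * R" "n \<le> 64 * R * 2 ^ k"
    and \<phi>: "theta (k + 1) \<le> \<phi>" "\<phi> < theta k"
    and \<rho>: "0 \<le> \<rho>" "\<rho> \<le> 1 / (4 * real R)"
    and p: "bump_centre k R m n = x + \<rho> *\<^sub>R vector [cos \<phi>, sin \<phi>]"
    using bump_centre_in_sector[OF assms(1-5)] by metis
  obtain i where i: "1 \<le> i" "i \<le> N k" "\<bar>\<phi> - angle N k i\<bar> \<le> gap N k"
    using nearest_angle[of N k \<phi>, OF assms(6) \<phi>] by metis
  define D t where "D = gap N k" and "t = angle N k i"
  have D: "0 < D" "\<bar>\<phi> - t\<bar> \<le> D" using gap_pos[of N k] assms i by (auto simp: D_def t_def)
  have R: "1 \<le> real R" using assms by simp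
  define q where "q = x + \<rho> *\<^sub>R (vector [cos t, sin t] :: real^2)"
  have "norm (vector [cos \<phi> - cos t, sin \<phi> - sin t] :: real^2) \<le> 2 * D"
    using norm_le_l1_cart[of "vector [cos \<phi> - cos t, sin \<phi> - sin t] :: real^2"]
      abs_sin_diff_le[of \<phi> t] abs_cos_diff_le[of \<phi> t] D(2) by (simp add: sum_2)
  moreover have "bump_centre k R m n - q = \<rho> *\<^sub>R vector [cos \<phi> - cos t, sin \<phi> - sin t]"
    by (simp add: p q_def vec_eq_iff forall_2 algebra_simps)
  ultimately have "dist (bump_centre k R m n) q \<le> \<rho> * (2 * D)"
    using \<rho>(1) by (simp add: dist_norm mult_left_mono)
  also have "\<dots> \<le> 1 / (4 * real R) * (2 * D)"
    using \<rho>(2) D by (intro mult_right_mono) auto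
  finally have d: "dist (bump_centre k R m n) q \<le> D / (2 * real R)" by simp
  have "sin D / (8 * real R) \<le> D / (8 * real R)"
    using sin_x_le_x[of D] D by (intro divide_right_mono) auto
  moreover have "D / (2 * real R) + D / (8 * real R) \<le> D / real R"
    using D R by (simp add: field_simps)
  ultimately have "dist (bump_centre k R m n) q + sin D / (8 * real R) \<le> D / real R"
    using d by linarith
  then have "ball q (sin D / (8 * real R)) \<subseteq> ball (bump_centre k R m n) (D / real R)"
    unfolding ball_subset_ball_iff by (simp add: dist_commute)
  also have "\<dots> \<subseteq> bumps D k R"
    unfolding bumps_def using mn by auto
  finally show thesis using that[OF i(1,2) \<rho>] by (simp add: q_def t_def D_def)
qed

subsection \<open>Orlicz mass and averages\<close>

text \<open>The constant is \<open>33 * 65 * 4\<close>: at most \<open>33 R * 65 R 2 ^ k\<close> balls, and \<open>pi < 4\<close>.\<close>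

lemma measure_bumps_le:
  assumes "0 \<le> D" "1 \<le> R"
  shows "measure lebesgue (bumps D k R) \<le> 8580 * 2 ^ k * D\<^sup>2"
proof -
  define I where "I = {..32 * R} \<times> {..64 * R * 2 ^ k}"
  have R: "1 \<le> real R" using assms by simp
  have "measure lebesgue (bumps D k R)
      \<le> (\<Sum>(m, n)\<in>I. measure lebesgue (ball (bump_centre k R m n) (D / real R)))"
    unfolding bumps_def I_def[symmetric] using measure_UNION_le[of I "\<lambda>(m, n). ball (bump_centre k R m n) (D / real R)" lebesgue]
    by (auto simp: I_def case_prod_unfold)
  also have "\<dots> = real (card I) * (pi * (D / real R)\<^sup>2)"
  proof -
    have "measure lebesgue (ball c (D / real R)) = pi * (D / real R)\<^sup>2" for c :: "real^2"
      using assms by (intro measure_ball_vec2) simp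
    then show ?thesis by (simp only: case_prod_unfold sum_constant)
  qed
  also have "\<dots> \<le> (33 * real R * (65 * real R * 2 ^ k)) * (4 * (D / real R)\<^sup>2)"
  proof (intro mult_mono)
    \<comment> \<open>Both index ranges include 0; this inequality absorbs the extra 1 into the
      factors 33 and 65.\<close>
    have "1 * 1 \<le> real R * 2 ^ k" using R by (intro mult_mono) auto
    then have "real (Suc (32 * R)) * real (Suc (64 * R * 2 ^ k)) \<le> 33 * real R * (65 * real R * 2 ^ k)"
      using R by (intro mult_mono) auto
    then show "real (card I) \<le> 33 * real R * (65 * real R * 2 ^ k)"
      by (simp only: I_def card_cartesian_product card_atMost of_nat_mult)
  qed (use pi_less_4 in auto)
  also have "\<dots> = 8580 * 2 ^ k * D\<^sup>2"
    using R by (simp add: power2_eq_square field_simps)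
  finally show ?thesis .
qed

text \<open>Since \<open>2 ^ k * gap N k = 1 / (2 * N k)\<close>, the mass below does not depend on the scale \<open>R\<close>,
  and its constant is \<open>8580 * 16 / 2\<close>.\<close>

lemma orlicz_bumps_le:
  assumes "0 < N k" "1 \<le> R" "1 \<le> M"
  shows "orlicz \<alpha> (16 * M / gap N k) * measure lebesgue (bumps (gap N k) k R)
     \<le> 68640 * M * ((1 + (ln (32 * M) + real k * ln 2 + ln (real (N k))) powr \<alpha>) / real (N k))"
proof -
  define D where "D = gap N k"
  have D: "0 < D" "D \<le> 1 / 2" using gap_pos[of N k] gap_le_half[of N k] assms by (auto simp: D_def)
  define h where "h = 16 * M / D"
  have "D \<le> 16 * M" using D assms by linarith
  then have h: "1 \<le> h" using D by (simp add: h_def)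
  \<comment> \<open>The factor \<open>2 ^ k\<close> of the height is the source of the term
    \<open>real k * ln 2\<close> in the logarithm, and so of the comparison of
    \<open>k powr \<alpha>\<close> with \<open>N k\<close>.\<close>
  have heq: "h = 32 * M * 2 ^ k * real (N k)"
    using assms by (simp add: h_def D_def gap_def theta_def)
  have "log_plus h = ln h" using h by (simp add: log_plus_def)
  also have "\<dots> = ln (32 * M) + real k * ln 2 + ln (real (N k))"
    unfolding heq using assms by (simp add: ln_mult ln_realpow)
  finally have lp: "log_plus h = ln (32 * M) + real k * ln 2 + ln (real (N k))" .
  have "orlicz \<alpha> h * measure lebesgue (bumps D k R) \<le> orlicz \<alpha> h * (8580 * 2 ^ k * D\<^sup>2)"
    using orlicz_ge[of h \<alpha>] h D assms by (intro mult_left_mono measure_bumps_le) auto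
  also have "\<dots> = (1 + log_plus h powr \<alpha>) * (8580 * 2 ^ k * D * (h * D))"
    by (simp add: orlicz_def power2_eq_square mult_ac)
  also have "h * D = 16 * M" using D by (simp add: h_def)
  also have "8580 * 2 ^ k * D * (16 * M) = 68640 * M / real (N k)"
    by (simp add: D_def gap_def theta_def)
  finally show ?thesis unfolding lp by (simp add: h_def D_def mult_ac)
qed

text \<open>The sum is at most three times the largest term. This argument covers exponents below 1
  as well as above.\<close>

lemma powr_add3_le:
  fixes a b c \<alpha> :: real
  assumes "0 \<le> a" "0 \<le> b" "0 \<le> c" "0 < \<alpha>"
  shows "(a + b + c) powr \<alpha> \<le> 3 powr \<alpha> * (a powr \<alpha> + b powr \<alpha> + c powr \<alpha>)"
proof -
  define m where "m = max a (max b c)"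
  have "(a + b + c) powr \<alpha> \<le> (3 * m) powr \<alpha>"
    using assms by (intro powr_mono2) (auto simp: m_def)
  also have "\<dots> = 3 powr \<alpha> * m powr \<alpha>"
    using assms by (simp add: powr_mult m_def)
  also have "\<dots> \<le> 3 powr \<alpha> * (a powr \<alpha> + b powr \<alpha> + c powr \<alpha>)"
    by (intro mult_left_mono) (auto simp: m_def max_def)
  finally show ?thesis .
qed

text \<open>The power splits into three terms: the one with \<open>c\<close> and the one with
  \<open>ln (N k)\<close> vanish against \<open>N k\<close> because \<open>N k\<close> tends to
  infinity, the one with \<open>k\<close> vanishes by the growth hypothesis.\<close>

lemma log_mass_tendsto_0:
  fixes N :: "nat \<Rightarrow> nat"
  assumes N: "\<And>k. 0 < N k" and \<alpha>: "0 < \<alpha>" and c: "0 \<le> c"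
    and o: "(\<lambda>k. real k powr \<alpha>) \<in> o(\<lambda>k. real (N k))"
  shows "(\<lambda>k. (1 + (c + real k * ln 2 + ln (real (N k))) powr \<alpha>) / real (N k)) \<longlonglongrightarrow> 0"
proof -
  \<comment> \<open>The growth hypothesis itself forces \<open>N k\<close> to infinity, being
    eventually at least \<open>k powr \<alpha>\<close>.\<close>
  have "\<forall>\<^sub>F k in sequentially. real k powr \<alpha> \<le> real (N k)"
    using landau_o.smallD[OF o, of 1] by simp
  moreover have "filterlim (\<lambda>k. real k powr \<alpha>) at_top sequentially"
    using \<alpha> by real_asymp
  ultimately have Ninf: "filterlim (\<lambda>k. real (N k)) at_top sequentially"
    by (rule filterlim_at_top_mono[rotated])
  have "((\<lambda>x. ln x powr \<alpha> / x) \<longlongrightarrow> 0) at_top"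
    using \<alpha> by real_asymp
  then have l1: "(\<lambda>k. ln (real (N k)) powr \<alpha> / real (N k)) \<longlonglongrightarrow> 0"
    using Ninf filterlim_compose by blast
  have l2: "(\<lambda>k. real k powr \<alpha> / real (N k)) \<longlonglongrightarrow> 0"
    using smalloD_tendsto[OF o] .
  have l3: "(\<lambda>k. C / real (N k)) \<longlonglongrightarrow> 0" for C
    using tendsto_divide_0[OF tendsto_const filterlim_at_top_imp_at_infinity[OF Ninf]] .
  have "(\<lambda>k. 1 / real (N k) + 3 powr \<alpha> * (c powr \<alpha> / real (N k) + real k powr \<alpha> / real (N k)
      + ln (real (N k)) powr \<alpha> / real (N k))) \<longlonglongrightarrow> 0 + 3 powr \<alpha> * (0 + 0 + 0)"
    by (intro tendsto_intros l1 l2 l3)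
  then have lim: "(\<lambda>k. 1 / real (N k) + 3 powr \<alpha> * (c powr \<alpha> / real (N k) + real k powr \<alpha> / real (N k)
      + ln (real (N k)) powr \<alpha> / real (N k))) \<longlonglongrightarrow> 0" by simp
  show ?thesis
  proof (rule tendsto_sandwich[OF _ _ tendsto_const lim]; intro always_eventually allI)
    fix k
    have N1: "1 \<le> real (N k)" using N[of k] by simp
    have ln2: "0 \<le> ln (2::real)" "ln (2::real) \<le> 1" using ln_2_less_1 by auto
    show "0 \<le> (1 + (c + real k * ln 2 + ln (real (N k))) powr \<alpha>) / real (N k)" by simp
    have "(c + real k * ln 2 + ln (real (N k))) powr \<alpha> \<le> (c + real k + ln (real (N k))) powr \<alpha>"
      using N1 c \<alpha> ln2 by (intro powr_mono2) (auto simp: mult_left_le)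
    also have "\<dots> \<le> 3 powr \<alpha> * (c powr \<alpha> + real k powr \<alpha> + ln (real (N k)) powr \<alpha>)"
      using N1 c \<alpha> by (intro powr_add3_le) auto
    finally have "(1 + (c + real k * ln 2 + ln (real (N k))) powr \<alpha>) / real (N k)
      \<le> (1 + 3 powr \<alpha> * (c powr \<alpha> + real k powr \<alpha> + ln (real (N k)) powr \<alpha>)) / real (N k)"
      using N1 by (intro divide_right_mono) auto
    then show "(1 + (c + real k * ln 2 + ln (real (N k))) powr \<alpha>) / real (N k)
      \<le> 1 / real (N k) + 3 powr \<alpha> * (c powr \<alpha> / real (N k) + real k powr \<alpha> / real (N k)
        + ln (real (N k)) powr \<alpha> / real (N k))"
      by (simp add: add_divide_distrib distrib_left)
  qed
qed

section \<open>Large averages over admissible rectangles\<close>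

lemma large_average:
  fixes f :: "real^2 \<Rightarrow> real"
  assumes N: "0 < N k" and R: "1 \<le> R" and \<sigma>: "\<And>i. 1 \<le> i \<Longrightarrow> i \<le> N k \<Longrightarrow> \<sigma> (angle N k i) = level_shape N k"
    and x: "0 \<le> x$1" "x$1 \<le> 1" "0 \<le> x$2" "x$2 \<le> 1"
    and f: "integrable lebesgue f" "\<And>y. 0 \<le> f y" and M: "0 \<le> M"
    and AE: "AE y in lebesgue. y \<in> bumps (gap N k) k R \<longrightarrow> 16 * M / gap N k \<le> f y"
  obtains B where "B \<in> rectangle_basis (angle_set N) \<sigma>" "x \<in> B" "bounded B" "diameter B \<le> 2 / real R"
    "M \<le> average f B"
proof -
  obtain i \<rho> where i: "1 \<le> i" "i \<le> N k" and \<rho>: "0 \<le> \<rho>" "\<rho> \<le> 1 / (4 * real R)"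
    and sub: "ball (x + \<rho> *\<^sub>R vector [cos (angle N k i), sin (angle N k i)]) (sin (gap N k) / (8 * real R))
       \<subseteq> bumps (gap N k) k R" (is "?S \<subseteq> _")
    using ball_subset_bumps[of x R N k, OF x R N] by metis
  define D where "D = gap N k"
  have D: "0 < D" "D \<le> 1 / 2" using gap_pos[of N k] gap_le_half[of N k] N by (auto simp: D_def)
  have Dsin: "D / 2 \<le> sin D" using sin_ge_half[of D] D by simp
  have sD: "0 < sin D" "sin D \<le> 1" "sin D \<le> 4"
    using Dsin D sin_le_one[of D] by linarith+
  have R': "1 \<le> real R" using R by simp
  \<comment> \<open>Length \<open>1 / R\<close> at the prescribed shape \<open>4 / sin D\<close>
    determines the short side.\<close>
  define a b where "a = 1 / real R" and "b = sin D / (4 * real R)"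
  have ab: "0 < b" "b \<le> a" using sD R' by (auto simp: a_def b_def field_simps)
  have a0: "0 < a" using ab by linarith
  define B where "B = rect x (angle N k i) a b"
  have "a / b = 4 / sin D" using R' sD by (simp add: a_def b_def)
  then have "a / b = \<sigma> (angle N k i)" using \<sigma>[OF i] by (simp add: level_shape_eq_gap D_def)
  then have "B \<in> rectangle_basis (angle_set N) \<sigma>"
    using ab i unfolding rectangle_basis_def B_def angle_set_def by blast
  moreover have "x \<in> B" using ab a0 by (simp add: B_def rect_def)
  moreover have Bsub: "B \<subseteq> cball x a" unfolding B_def using rect_subset_cball[OF ab] .
  then have "bounded B" using bounded_subset bounded_cball by blast
  moreover have "diameter B \<le> 2 / real R"
    using diameter_subset[OF Bsub bounded_cball] a0 by (simp add: a_def)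
  moreover have "M \<le> average f B"
  proof -
    have "sin (gap N k) / (8 * real R) = b / 2" by (simp add: b_def D_def)
    then have S: "?S = ball (x + \<rho> *\<^sub>R vector [cos (angle N k i), sin (angle N k i)]) (b / 2)"
      by (rule arg_cong)
    have "sin D / (8 * real R) \<le> 1 / (8 * real R)" using sD R' by (intro divide_right_mono) auto
    then have "\<rho> + b / 2 \<le> 1 / (4 * real R) + 1 / (8 * real R)"
      using \<rho> by (simp add: b_def)
    also have "\<dots> \<le> a / 2" using R' by (simp add: a_def field_simps)
    finally have SB: "?S \<subseteq> B"
      unfolding B_def S using \<rho> by (intro ball_subset_rect) auto
    have "AE y in lebesgue. y \<in> ?S \<longrightarrow> 16 * M / D \<le> f y"
      using AE by eventually_elim (use sub in \<open>auto simp: D_def\<close>)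
    then have avg: "16 * M / D * measure lebesgue ?S / measure lebesgue B \<le> average f B"
      using D M a0 ab SB by (intro average_ge f) (auto simp: B_def lmeasurable_rect)
    have mS: "measure lebesgue ?S = pi * (b / 2)\<^sup>2"
      unfolding S using ab by (intro measure_ball_vec2) auto
    have mB: "measure lebesgue B = a * b"
      unfolding B_def using a0 ab by (intro measure_rect) auto
    \<comment> \<open>The 16 in the height of \<open>f\<close> compensates two factors 4: one from
      the squared radius \<open>b / 2\<close>, one from the shape. What remains is at least
      \<open>M\<close> since \<open>pi\<close> exceeds 2 and \<open>sin D\<close> is at least
      \<open>D / 2\<close>.\<close>
    have quot: "16 * M / D * (pi * (b / 2)\<^sup>2) / (a * b) = M * (pi * sin D / D)"
      using R' sD by (simp add: a_def b_def power2_eq_square field_simps)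
    have one: "1 \<le> pi * sin D / D"
    proof -
      have "2 * (D / 2) \<le> pi * sin D" using pi_gt3 Dsin D by (intro mult_mono) auto
      then show ?thesis using D by simp
    qed
    have "M \<le> M * (pi * sin D / D)"
      using mult_left_mono[OF one M] by simp
    also have "\<dots> \<le> average f B"
      using avg unfolding mS mB quot .
    finally show ?thesis .
  qed
  ultimately show thesis using that by blast
qed

section \<open>Combining the bumps into one function\<close>

theorem corollary7:
  fixes N :: "nat \<Rightarrow> nat" and \<sigma> :: "real \<Rightarrow> real" and \<alpha> :: real
  assumes "\<And>k. 0 < N k"
    and "\<And>k i. 1 \<le> i \<Longrightarrow> i \<le> N k \<Longrightarrow> \<sigma> (angle N k i) = level_shape N k"
    and "0 < \<alpha>"
    and "(\<lambda>k. real k powr \<alpha>) \<in> o(\<lambda>k. real (N k))"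
  shows "\<not> differentiates (rectangle_basis (angle_set N) \<sigma>) (LlogL \<alpha>)"
proof
  assume diff: "differentiates (rectangle_basis (angle_set N) \<sigma>) (LlogL \<alpha>)"
  \<comment> \<open>The target \<open>j + 1\<close> for the averages is fixed first and the level
    \<open>k\<close> chosen afterwards. As the mass bound is the same for all scales,
    \<open>R = j + 1\<close> can be prescribed as well.\<close>
  have "\<exists>k. orlicz \<alpha> (16 * (real j + 1) / gap N k) * measure lebesgue (bumps (gap N k) k (j + 1)) \<le> (1 / 2) ^ j" for j
  proof -
    define M where "M = real j + 1"
    have M: "1 \<le> M" by (simp add: M_def)
    have "(\<lambda>k. 68640 * M * ((1 + (ln (32 * M) + real k * ln 2 + ln (real (N k))) powr \<alpha>) / real (N k))) \<longlonglongrightarrow> 68640 * M * 0"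
      using M assms by (intro tendsto_mult tendsto_const log_mass_tendsto_0) auto
    then have "\<forall>\<^sub>F k in sequentially. 68640 * M * ((1 + (ln (32 * M) + real k * ln 2 + ln (real (N k))) powr \<alpha>) / real (N k)) < (1 / 2) ^ j"
      by (rule order_tendstoD) simp
    then obtain k where "68640 * M * ((1 + (ln (32 * M) + real k * ln 2 + ln (real (N k))) powr \<alpha>) / real (N k)) < (1 / 2) ^ j"
      using eventually_happens by fastforce
    then show ?thesis
      using orlicz_bumps_le[of N k "j + 1" M \<alpha>, OF assms(1) _ M] unfolding M_def by (intro exI[of _ k]) auto
  qed
  then obtain K where K: "\<And>j. orlicz \<alpha> (16 * (real j + 1) / gap N (K j))
      * measure lebesgue (bumps (gap N (K j)) (K j) (j + 1)) \<le> (1 / 2) ^ j"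
    by metis
  define h where "h j = 16 * (real j + 1) / gap N (K j)" for j
  define A where "A j = bumps (gap N (K j)) (K j) (j + 1)" for j
  have h: "1 \<le> h j" for j
  proof -
    have "gap N (K j) \<le> 16 * (real j + 1)" using gap_le_half[of N "K j"] assms(1) by force
    then show ?thesis using gap_pos[of N "K j"] assms(1) by (simp add: h_def)
  qed
  have summ: "summable (\<lambda>j. orlicz \<alpha> (h j) * measure lebesgue (A j))"
  proof (rule summable_comparison_test')
    show "summable (\<lambda>j. (1 / 2 :: real) ^ j)" by (simp add: summable_geometric)
    show "norm (orlicz \<alpha> (h j) * measure lebesgue (A j)) \<le> (1 / 2) ^ j" if "j \<ge> 0" for j
    proof -
      have "0 \<le> orlicz \<alpha> (h j)" using orlicz_ge[of "h j" \<alpha>] h[of j] by linarith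
      then show ?thesis using K[of j] by (simp add: h_def A_def abs_mult)
    qed
  qed
  have A_meas: "A j \<in> lmeasurable" for j unfolding A_def by (rule lmeasurable_bumps)
  obtain f where f: "f \<in> LlogL \<alpha>" "\<And>x. 0 \<le> f x" "integrable lebesgue f"
    and big: "AE x in lebesgue. \<forall>j. x \<in> A j \<longrightarrow> h j \<le> f x"
    by (rule LlogL_supremum[OF h A_meas summ]) blast
  \<comment> \<open>The open unit square, written as a \<open>rect\<close> of angle 0 so that
    \<open>measure_rect\<close> gives its area.\<close>
  define Q where "Q = rect (vector [1/2, 1/2]) 0 1 1"
  define P where "P x \<longleftrightarrow> (\<forall>\<epsilon>>0. \<exists>\<delta>>0. \<forall>B\<in>rectangle_basis (angle_set N) \<sigma>.
        x \<in> B \<and> bounded B \<and> diameter B < \<delta> \<longrightarrow> \<bar>average f B - f x\<bar> < \<epsilon>)" for x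
  have "AE x in lebesgue. P x"
    using diff f(1) by (simp add: differentiates_def differentiates_integral_def P_def)
  \<comment> \<open>The exceptional null set of the differentiation property cannot cover a set of
    measure 1.\<close>
  have "\<exists>x\<in>Q. P x"
  proof (rule ccontr)
    assume "\<not> (\<exists>x\<in>Q. P x)"
    then have "AE x in lebesgue. x \<notin> Q"
      using \<open>AE x in lebesgue. P x\<close> by (auto elim: eventually_mono)
    moreover have "Q \<in> lmeasurable" "measure lebesgue Q = 1"
      unfolding Q_def by (simp_all add: lmeasurable_rect measure_rect)
    ultimately show False
      using AE_iff_null_sets[of Q lebesgue] by (auto simp: null_sets_def measure_def fmeasurable_def)
  qed
  then obtain x where x: "x \<in> Q" "P x" by blast
  have x01: "0 \<le> x$1" "x$1 \<le> 1" "0 \<le> x$2" "x$2 \<le> 1"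
  proof -
    have b: "\<bar>x$1 - 1/2\<bar> < 1/2" "\<bar>x$2 - 1/2\<bar> < 1/2"
      using x(1) by (simp_all add: Q_def rect_def inner_vec_def sum_2)
    show "0 \<le> x$1" "x$1 \<le> 1" "0 \<le> x$2" "x$2 \<le> 1"
      using b unfolding abs_less_iff by linarith+
  qed
  obtain \<delta> where \<delta>: "0 < \<delta>" "\<And>B. B \<in> rectangle_basis (angle_set N) \<sigma> \<Longrightarrow> x \<in> B \<Longrightarrow> bounded B
      \<Longrightarrow> diameter B < \<delta> \<Longrightarrow> \<bar>average f B - f x\<bar> < 1"
    using x(2) unfolding P_def by (metis zero_less_one)
  \<comment> \<open>One index that makes the average, at least \<open>j + 1\<close>, exceed
    \<open>f x + 1\<close> and the diameter, at most \<open>2 / (j + 1)\<close>, fall below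
    \<open>\<delta>\<close>; this contradicts the choice of \<open>\<delta>\<close> for tolerance
    1.\<close>
  obtain j :: nat where j: "max (f x + 1) (2 / \<delta>) < real j"
    using reals_Archimedean2 by blast
  have "2 / \<delta> < real (j + 1)" using j by simp
  then have small: "2 / real (j + 1) < \<delta>" using \<delta>(1) by (simp add: field_simps)
  have AEj: "AE y in lebesgue. y \<in> bumps (gap N (K j)) (K j) (j + 1) \<longrightarrow> 16 * (real j + 1) / gap N (K j) \<le> f y"
    using big by eventually_elim (auto simp: A_def h_def)
  obtain B where "B \<in> rectangle_basis (angle_set N) \<sigma>" "x \<in> B" "bounded B"
    "diameter B \<le> 2 / real (j + 1)" "real j + 1 \<le> average f B"
    by (rule large_average[of N "K j" "j + 1" \<sigma> x f "real j + 1", OF assms(1) _ assms(2) x01 f(3,2) _ AEj]) auto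
  moreover from this have "\<bar>average f B - f x\<bar> < 1" using small by (intro \<delta>(2)) auto
  ultimately show False using j by linarith
qed

end
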